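(* Let $x^*$ be a locally optimal solution of the problem $(\mathcal{P})$: $\min f(x)$ subject to $x\in M$, $x\in A$. For the penalty function $F_\lambda = f+\lambda\varphi$ to be exact at the point $x^*$ it is necessary and sufficient that $\overline{\lambda}(x^* )<+\infty$, where $\overline{\lambda}(x^* ) = \limsup_{y\to x^*,\, y\in A\setminus M}\frac{f(x^* )-f(y)}{\varphi(y)-\varphi(x^* )}$. Furthermore, if $F_\lambda$ is exact at $x^*$, then $\lambda^*(x^* )=\max\{\overline{\lambda}(x^* ),0\}$.
   Context: $X$ is a topological space, $M,A\subset X$ are nonempty, $f\colon X\to\mathbb{R}\cup\{+\infty\}$, and $\varphi\colon X\to[0,+\infty)$ satisfies $M=\{x\in X\mid\varphi(x)=0\}$. Put $\Omega=M\cap A$; it is assumed that $f(x)<+\infty$ for some $x\in\Omega$. For $\lambda\ge0$, $F_\lambda(x)=f(x)+\lambda\varphi(x)$. A locally optimal solution of $(\mathcal{P})$ is a point $x^*\in\Omega$ that is a local minimizer of $f$ on $\Omega$; it is always assumed that $f(x^* )<+\infty$. The penalty function $F_\lambda$ is exact at a locally optimal solution $x^*$ if there exists $\lambda^*\ge0$ such that $x^*$ is a point of local minimum of $F_{\lambda^*}$ on $A$; the infimum of all such $\lambda^*\ge 0$ is denoted $\lambda^*(x^* )$ (the least exact penalty parameter at $x^*$). The limit superior is the infimum over neighbourhoods $U$ of $x^*$ of the supremum of the quotient over $y\in U\cap(A\setminus M)$; by definition $\overline{\lambda}(x^* )=-\infty$ if $x^*$ is not a limit point of $A\setminus M$. 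*)

theory Defs
  imports "HOL-Analysis.Analysis"
begin

definition local_min_on :: "('a::topological_space \<Rightarrow> ereal) \<Rightarrow> 'a set \<Rightarrow> 'a \<Rightarrow> bool" where
  "local_min_on g S x \<longleftrightarrow> x \<in> S \<and> (\<exists>U. open U \<and> x \<in> U \<and> (\<forall>y \<in> U \<inter> S. g x \<le> g y))"

text \<open>Finiteness of the optimal value is part of the notion.\<close>

definition locally_optimal :: "('a::topological_space \<Rightarrow> ereal) \<Rightarrow> 'a set \<Rightarrow> 'a set \<Rightarrow> 'a \<Rightarrow> bool" where
  "locally_optimal f M A x \<longleftrightarrow> local_min_on f (M \<inter> A) x \<and> f x < \<infinity>"

definition penalty_fun :: "('a \<Rightarrow> ereal) \<Rightarrow> ('a \<Rightarrow> real) \<Rightarrow> real \<Rightarrow> 'a \<Rightarrow> ereal" where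
  "penalty_fun f \<phi> l x = f x + ereal (l * \<phi> x)"

definition exact_penalty_params ::
    "('a::topological_space \<Rightarrow> ereal) \<Rightarrow> ('a \<Rightarrow> real) \<Rightarrow> 'a set \<Rightarrow> 'a \<Rightarrow> real set" where
  "exact_penalty_params f \<phi> A x = {l. 0 \<le> l \<and> local_min_on (penalty_fun f \<phi> l) A x}"

definition exact_at ::
    "('a::topological_space \<Rightarrow> ereal) \<Rightarrow> ('a \<Rightarrow> real) \<Rightarrow> 'a set \<Rightarrow> 'a \<Rightarrow> bool" where
  "exact_at f \<phi> A x \<longleftrightarrow> (\<exists>l. l \<in> exact_penalty_params f \<phi> A x)"

text \<open>The infimum is taken in the extended reals.\<close>

definition least_exact_param ::
    "('a::topological_space \<Rightarrow> ereal) \<Rightarrow> ('a \<Rightarrow> real) \<Rightarrow> 'a set \<Rightarrow> 'a \<Rightarrow> ereal" where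
  "least_exact_param f \<phi> A x = Inf (ereal ` exact_penalty_params f \<phi> A x)"

text \<open>
  If \<open>x\<close> is not a limit point of \<open>A - M\<close>, the filter is trivial and the upper limit is \<open>-\<infinity>\<close>.
  The filter excludes the point \<open>x\<close> itself, which makes no difference for \<open>x \<in> M\<close>;
  see the lemmas below.
\<close>

definition lambda_bar ::
    "('a::topological_space \<Rightarrow> ereal) \<Rightarrow> ('a \<Rightarrow> real) \<Rightarrow> 'a set \<Rightarrow> 'a set \<Rightarrow> 'a \<Rightarrow> ereal" where
  "lambda_bar f \<phi> M A x =
     Limsup (at x within (A - M)) (\<lambda>y. (f x - f y) / ereal (\<phi> y - \<phi> x))"

lemma lambda_bar_not_islimpt:
  assumes "\<not> x islimpt (A - M)"
  shows "lambda_bar f \<phi> M A x = - \<infinity>"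
proof -
  have "at x within (A - M) = bot"
    using assms by (simp add: trivial_limit_within)
  then show ?thesis
    by (simp add: lambda_bar_def bot_ereal_def)
qed

lemma lambda_bar_eq_INF_SUP:
  assumes "x \<in> M"
  shows "lambda_bar f \<phi> M A x =
    (INF U \<in> {U. open U \<and> x \<in> U}. SUP y \<in> U \<inter> (A - M). (f x - f y) / ereal (\<phi> y - \<phi> x))"
    (is "_ = (INF U \<in> ?N. SUP y \<in> U \<inter> ?S. ?q y)")
proof (rule antisym)
  show "lambda_bar f \<phi> M A x \<le> (INF U \<in> ?N. SUP y \<in> U \<inter> ?S. ?q y)"
  proof (rule INF_greatest)
    fix U assume "U \<in> ?N"
    then have "eventually (\<lambda>y. y \<in> U \<inter> ?S) (at x within ?S)"
      by (auto simp: eventually_at_topological)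
    then have "lambda_bar f \<phi> M A x \<le> (SUP y \<in> Collect (\<lambda>y. y \<in> U \<inter> ?S). ?q y)"
      unfolding lambda_bar_def Limsup_def by (intro INF_lower) simp
    then show "lambda_bar f \<phi> M A x \<le> (SUP y \<in> U \<inter> ?S. ?q y)"
      by (simp only: Collect_mem_eq)
  qed
next
  show "(INF U \<in> ?N. SUP y \<in> U \<inter> ?S. ?q y) \<le> lambda_bar f \<phi> M A x"
    unfolding lambda_bar_def Limsup_def
  proof (rule INF_greatest)
    fix P assume "P \<in> {P. eventually P (at x within ?S)}"
    then obtain U where U: "open U" "x \<in> U" "\<forall>y\<in>U. y \<noteq> x \<longrightarrow> y \<in> ?S \<longrightarrow> P y"
      by (auto simp: eventually_at_topological)
    have "(INF U \<in> ?N. SUP y \<in> U \<inter> ?S. ?q y) \<le> (SUP y \<in> U \<inter> ?S. ?q y)"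
      using U by (intro INF_lower) simp
    also have "\<dots> \<le> (SUP y \<in> Collect P. ?q y)"
      using U assms by (intro SUP_subset_mono) auto
    finally show "(INF U \<in> ?N. SUP y \<in> U \<inter> ?S. ?q y) \<le> (SUP y \<in> Collect P. ?q y)" .
  qed
qed

end

(* For y in A - M near x, the inequality F_l(x) <= F_l(y) says exactly that the difference quotient
   at y is at most l, while on M the penalty vanishes and F_l = f is minimal at x by local
   optimality. Hence every l > max(lambda_bar, 0) is an exact penalty parameter, and every exact
   penalty parameter is at least max(lambda_bar, 0). *)

theory Submission
  imports Defs
begin

text \<open>For finite \<open>f y\<close> this is multiplication by the positive number
  \<open>\<phi> y\<close>. If \<open>f y\<close> is infinite, the quotient is minus infinity and the
  penalty function at \<open>y\<close> is infinity, so both sides hold.\<close>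

lemma quotient_le_iff_penalty_fun_le:
  fixes f :: "'a \<Rightarrow> ereal"
  assumes "\<bar>f x\<bar> \<noteq> \<infinity>" "f y \<noteq> - \<infinity>" "\<phi> x = 0" "0 < \<phi> y"
  shows "(f x - f y) / ereal (\<phi> y - \<phi> x) \<le> ereal l
    \<longleftrightarrow> penalty_fun f \<phi> l x \<le> penalty_fun f \<phi> l y"
proof -
  obtain a where "f x = ereal a"
    using assms(1) by auto
  with assms show ?thesis
    by (cases "f y") (auto simp: penalty_fun_def field_simps)
qed

text \<open>A neighbourhood on which \<open>x\<close> minimizes the penalty function bounds all
  quotients there by \<open>l\<close>, hence also their upper limit. If \<open>x\<close> is not a
  limit point of \<open>A - M\<close>, the upper limit is minus infinity and the bound is
  trivial.\<close>

lemma lambda_bar_le_exact_param: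
  assumes "\<bar>f x\<bar> \<noteq> \<infinity>" "\<And>y. f y \<noteq> - \<infinity>" "\<phi> x = 0" "\<And>y. y \<notin> M \<Longrightarrow> 0 < \<phi> y"
    and "local_min_on (penalty_fun f \<phi> l) A x"
  shows "lambda_bar f \<phi> M A x \<le> ereal l"
proof -
  obtain U where "open U" "x \<in> U"
    and min: "\<And>y. y \<in> U \<inter> A \<Longrightarrow> penalty_fun f \<phi> l x \<le> penalty_fun f \<phi> l y"
    using assms(5) unfolding local_min_on_def by auto
  then have "eventually (\<lambda>y. y \<in> U \<inter> (A - M)) (at x within (A - M))"
    by (auto simp: eventually_at_topological)
  then have "eventually (\<lambda>y. (f x - f y) / ereal (\<phi> y - \<phi> x) \<le> ereal l) (at x within (A - M))"
  proof (rule eventually_mono)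
    fix y assume "y \<in> U \<inter> (A - M)"
    then show "(f x - f y) / ereal (\<phi> y - \<phi> x) \<le> ereal l"
      using quotient_le_iff_penalty_fun_le[of f x y \<phi> l] assms min by simp
  qed
  then show ?thesis
    unfolding lambda_bar_def by (rule Limsup_bounded)
qed

text \<open>Strictness of \<open>less\<close> matters: an upper limit strictly below
  \<open>l\<close> forces the quotients below \<open>l\<close> near \<open>x\<close>, whereas one
  equal to \<open>l\<close> would not.\<close>

lemma local_min_on_penalty_fun:
  assumes "\<And>y. f y \<noteq> - \<infinity>" "\<And>y. y \<in> M \<Longrightarrow> \<phi> y = 0" "\<And>y. y \<notin> M \<Longrightarrow> 0 < \<phi> y"
    and opt: "locally_optimal f M A x" and less: "lambda_bar f \<phi> M A x < ereal l"
  shows "local_min_on (penalty_fun f \<phi> l) A x"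
proof -
  obtain U where x: "x \<in> M" "x \<in> A" "\<bar>f x\<bar> \<noteq> \<infinity>" and U: "open U" "x \<in> U"
    and min: "\<And>y. y \<in> U \<inter> (M \<inter> A) \<Longrightarrow> f x \<le> f y"
    using opt assms(1)[of x] unfolding locally_optimal_def local_min_on_def by auto
  have "eventually (\<lambda>y. (f x - f y) / ereal (\<phi> y - \<phi> x) < ereal l) (at x within (A - M))"
    using less unfolding lambda_bar_def by (rule Limsup_lessD)
  then obtain V where V: "open V" "x \<in> V"
    and q: "\<And>y. y \<in> V \<Longrightarrow> y \<noteq> x \<Longrightarrow> y \<in> A - M
      \<Longrightarrow> (f x - f y) / ereal (\<phi> y - \<phi> x) < ereal l"
    unfolding eventually_at_topological by blast
  have "penalty_fun f \<phi> l x \<le> penalty_fun f \<phi> l y" if "y \<in> (U \<inter> V) \<inter> A" for y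
  proof (cases "y \<in> M")
    case True
    then show ?thesis
      using that x min[of y] assms(2) by (simp add: penalty_fun_def)
  next
    case False
    \<comment> \<open>Since \<open>x\<close> lies in \<open>M\<close> and \<open>y\<close> does not,
      \<open>y\<close> differs from \<open>x\<close>, as the punctured filter requires.\<close>
    then have "(f x - f y) / ereal (\<phi> y - \<phi> x) \<le> ereal l"
      using that x(1) q[of y] by fastforce
    then show ?thesis
      using quotient_le_iff_penalty_fun_le[of f x y \<phi> l] False x assms by simp
  qed
  then show ?thesis
    unfolding local_min_on_def using x(2) U V by (intro conjI exI[of _ "U \<inter> V"]) auto
qed

theorem theorem2p3:
  fixes f :: "'a::topological_space \<Rightarrow> ereal"
    and \<phi> :: "'a \<Rightarrow> real"
    and M A :: "'a set"
    and x\<^sub>0 :: 'a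
  assumes "M \<noteq> {}" and "A \<noteq> {}"
    and "\<And>x. f x \<noteq> - \<infinity>"
    and "\<And>x. 0 \<le> \<phi> x"
    and "M = {x. \<phi> x = 0}"
    and "\<exists>x \<in> M \<inter> A. f x < \<infinity>"
    and "locally_optimal f M A x\<^sub>0"
  shows "(exact_at f \<phi> A x\<^sub>0 \<longleftrightarrow> lambda_bar f \<phi> M A x\<^sub>0 < \<infinity>) \<and>
         (exact_at f \<phi> A x\<^sub>0 \<longrightarrow> least_exact_param f \<phi> A x\<^sub>0 = max (lambda_bar f \<phi> M A x\<^sub>0) 0)"
proof -
  let ?P = "exact_penalty_params f \<phi> A x\<^sub>0"
  let ?m = "max (lambda_bar f \<phi> M A x\<^sub>0) 0"
  have zero: "\<phi> y = 0" if "y \<in> M" for y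
    using that assms(5) by simp
  have pos: "0 < \<phi> y" if "y \<notin> M" for y
    using that assms(4)[of y] assms(5) by auto
  have x: "\<phi> x\<^sub>0 = 0" "\<bar>f x\<^sub>0\<bar> \<noteq> \<infinity>"
    using assms(3)[of x\<^sub>0] assms(7) zero unfolding locally_optimal_def local_min_on_def by auto
  have lower: "?m \<le> ereal l" if "l \<in> ?P" for l
    using that lambda_bar_le_exact_param[of f x\<^sub>0 \<phi> M l A] x assms(3) pos
    unfolding exact_penalty_params_def by simp
  \<comment> \<open>The maximum with 0 in \<open>?m\<close> supplies the sign condition on
    \<open>l\<close>.\<close>
  have upper: "l \<in> ?P" if "?m < ereal l" for l
    using that local_min_on_penalty_fun[of f M \<phi> A x\<^sub>0 l] assms(3,7) zero pos
    unfolding exact_penalty_params_def by simp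
  have "lambda_bar f \<phi> M A x\<^sub>0 < \<infinity>" if "exact_at f \<phi> A x\<^sub>0"
    using that lower unfolding exact_at_def by (auto intro: le_less_trans)
  moreover have "exact_at f \<phi> A x\<^sub>0" if "lambda_bar f \<phi> M A x\<^sub>0 < \<infinity>"
  proof -
    from that have "?m < \<infinity>"
      by (simp add: max_def)
    then show ?thesis
      unfolding exact_at_def using upper ereal_dense2 by blast
  qed
  \<comment> \<open>If \<open>?m\<close> is infinite, \<open>lower\<close> makes \<open>?P\<close>
    empty, and its infimum in the extended reals is infinity as well.\<close>
  moreover have "least_exact_param f \<phi> A x\<^sub>0 = ?m"
    unfolding least_exact_param_def
  proof (rule antisym)
    show "?m \<le> Inf (ereal ` ?P)"
      using lower by (auto intro: INF_greatest)
    show "Inf (ereal ` ?P) \<le> ?m"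
    \<comment> \<open>The value \<open>?m\<close> itself can fail to be an exact parameter, so it is
      approached from above through real numbers \<open>l\<close>.\<close>
    proof (rule dense_ge)
      fix y assume "?m < y"
      then obtain l where "?m < ereal l" "ereal l < y"
        using ereal_dense2 by blast
      then show "Inf (ereal ` ?P) \<le> y"
        using upper by (meson INF_lower less_imp_le order_trans)
    qed
  qed
  ultimately show ?thesis
    by blast
qed

end
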